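(* Let $\ell=\lceil k/2\rceil$. (1) For odd $k$, the number of L-matchings of $X_{2k}$ of size $k$ is $\frac{2}{3}\cdot\frac{\ell-1}{\ell}\binom{4\ell-2}{\ell-1}$. (2) For even $k$, the number of L-matchings of $X_{2k}$ of size $k$ is $\frac{\ell+1}{3\ell+1}\binom{4\ell}{\ell}$.
   Context: Let $k\ge 1$ and let $X_{2k}=\{P_1,\dots,P_{2k}\}$ be $2k$ points in convex position in the plane, labeled in clockwise cyclic order; indices are taken modulo $2k$. A matching of $X_{2k}$ means a set of $k$ pairwise non-crossing straight segments (edges) with endpoints in $X_{2k}$ covering every point exactly once; its size is $k$. Matchings with different labels are counted as different. The rings of $X_{2k}$ ($k\ge 2$) are the two matchings consisting only of edges between consecutive points: $\{P_1P_2,P_3P_4,\dots,P_{2k-1}P_{2k}\}$ and $\{P_2P_3,P_4P_5,\dots,P_{2k}P_1\}$. A block of a matching $M$ is a pair of edges $\{P_iP_{i+3},P_{i+1}P_{i+2}\}\subseteq M$. If $K$ is a block of a matching $N$ of size $k+2$, then $N-K$ denotes the set $N\setminus K$, regarded as a matching of the remaining $2k$ points (which are in convex position) with their inherited cyclic order, i.e. as a matching of size $k$ defined up to cyclic relabeling. L-matchings are defined recursively: a matching of size $2$ or $3$ is an L-matching iff it is a ring; no matching of size $1$ is an L-matching; for $k\ge 4$, a matching $N$ of size $k$ is an L-matching iff it has a block $K$ such that $N-K$ is an L-matching. *)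

theory Defs
  imports Complex_Main
begin

text \<open>Points P_1,...,P_n (n = 2k) are encoded as 0,...,n-1 in clockwise order.
  An edge is a two-element set of points; a matching is a set of edges.\<close>

definition crosses :: "nat \<Rightarrow> nat \<Rightarrow> nat \<Rightarrow> nat \<Rightarrow> bool" where
  "crosses a b c d \<longleftrightarrow> a < c \<and> c < b \<and> b < d"

definition is_matching :: "nat \<Rightarrow> nat set set \<Rightarrow> bool" where
  "is_matching n M \<longleftrightarrow>
     (\<forall>e\<in>M. \<exists>a b. e = {a, b} \<and> a < b \<and> b < n) \<and>
     (\<forall>p<n. \<exists>!e. e \<in> M \<and> p \<in> e) \<and>
     (\<forall>a b c d. {a, b} \<in> M \<longrightarrow> {c, d} \<in> M \<longrightarrow> \<not> crosses a b c d)"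

definition ring1 :: "nat \<Rightarrow> nat set set" where
  "ring1 k = {{2*j, 2*j+1} | j. j < k}"

definition ring2 :: "nat \<Rightarrow> nat set set" where
  "ring2 k = {{2*j+1, (2*j+2) mod (2*k)} | j. j < k}"

definition block_at :: "nat \<Rightarrow> nat \<Rightarrow> nat set set" where
  "block_at n i = {{i mod n, (i+3) mod n}, {(i+1) mod n, (i+2) mod n}}"

definition block_pts :: "nat \<Rightarrow> nat \<Rightarrow> nat set" where
  "block_pts n i = {i mod n, (i+1) mod n, (i+2) mod n, (i+3) mod n}"

text \<open>Order-preserving relabeling of the remaining points onto 0,...,n-5.\<close>
definition relabel :: "nat set \<Rightarrow> nat \<Rightarrow> nat" where
  "relabel R p = p - card {r \<in> R. r < p}"

definition remove_block :: "nat \<Rightarrow> nat set set \<Rightarrow> nat \<Rightarrow> nat set set" where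
  "remove_block n N i = (\<lambda>e. relabel (block_pts n i) ` e) ` (N - block_at n i)"

inductive L_matching :: "nat \<Rightarrow> nat set set \<Rightarrow> bool" where
  ring: "k \<in> {2, 3} \<Longrightarrow> (M = ring1 k \<or> M = ring2 k) \<Longrightarrow> L_matching k M"
| step: "k \<ge> 4 \<Longrightarrow> is_matching (2*k) N \<Longrightarrow> i < 2*k \<Longrightarrow> block_at (2*k) i \<subseteq> N
         \<Longrightarrow> L_matching (k - 2) (remove_block (2*k) N i) \<Longrightarrow> L_matching k N"

end

theory Submission
  imports Defs "HOL-Computational_Algebra.Formal_Power_Series"
begin

text \<open>Non-crossing matchings of \<open>2k\<close> points are dual to rooted plane trees with \<open>k\<close> edges, and removing a
  block means deleting a pendant path of length 2. Hence, for even \<open>k\<close>, the L-matchings are the trees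
  having a matching that misses exactly one vertex, and for odd \<open>k\<close> the trees that consist of a claw
  and a perfect matching of the remaining vertices. Both properties are recognised bottom-up by a
  finite automaton in which a child consisting of a single edge acts as the identity, so they are invariant
  under the insertion of blocks; the blocks containing both the first and the last point are three
  explicit cases.

  For the generating functions, the trees in which only the root is unmatched satisfy
  \<open>F = 1 + z^2 F^4\<close>. The even case has generating function \<open>F + z F' / 2\<close>, which accounts for the factor
  \<open>l + 1\<close>, and the odd case has \<open>z^2 (F^3)' / 3\<close>.
  The recurrence \<open>F^(r+1) = F^r + z^2 F^(r+4)\<close> determines the coefficients of all powers of \<open>F\<close>,
  without Lagrange inversion.\<close>

section \<open>Arc systems and matchings\<close>

text \<open>\<open>Arch a b\<close> is the arc system \<open>(a)b\<close> in parenthesis notation: an arc over \<open>a\<close>, followed by \<open>b\<close>.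
  Read as a plane tree, it is the root of \<open>b\<close> with the tree \<open>a\<close> attached as a new leftmost child.\<close>

datatype arcs = Empty | Arch arcs arcs

text \<open>The argument \<open>s\<close> is the first point of the interval of
  \<open>2 * size t\<close> points on which the arcs are drawn; \<open>size\<close> counts
  arcs.\<close>

primrec edges :: "nat \<Rightarrow> arcs \<Rightarrow> nat set set" where
  "edges s Empty = {}"
| "edges s (Arch a b) =
     insert {s, s + 1 + 2 * size a} (edges (s + 1) a \<union> edges (s + 2 + 2 * size a) b)"

abbreviation arch1 :: arcs where
  "arch1 \<equiv> Arch Empty Empty"

lemma size_arcs_0 [simp]: "size t = 0 \<longleftrightarrow> t = Empty"
  by (cases t) auto

lemma size_arcs_1: "size t = Suc 0 \<longleftrightarrow> t = arch1"
  by (cases t) auto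

lemma edges_bounds:
  "e \<in> edges s t \<Longrightarrow> \<exists>a b. e = {a, b} \<and> s \<le> a \<and> a < b \<and> b < s + 2 * size t"
proof (induction t arbitrary: s)
  case Empty
  then show ?case by simp
next
  case (Arch t1 t2)
  from Arch.prems consider "e = {s, s + 1 + 2 * size t1}" | "e \<in> edges (s + 1) t1"
    | "e \<in> edges (s + 2 + 2 * size t1) t2" by auto
  then show ?case
  proof cases
    case 1
    then show ?thesis by (intro exI[of _ s] exI[of _ "s + 1 + 2 * size t1"]) simp
  next
    case 2
    from Arch.IH(1)[OF this] obtain a b where
      "e = {a, b}" "s + 1 \<le> a" "a < b" "b < s + 1 + 2 * size t1" by blast
    then show ?thesis by (intro exI[of _ a] exI[of _ b]) simp
  next
    case 3
    from Arch.IH(2)[OF this] obtain a b where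
      "e = {a, b}" "s + 2 + 2 * size t1 \<le> a" "a < b"
      "b < s + 2 + 2 * size t1 + 2 * size t2" by blast
    then show ?thesis by (intro exI[of _ a] exI[of _ b]) simp
  qed
qed

lemma edges_mem_bounds:
  "e \<in> edges s t \<Longrightarrow> p \<in> e \<Longrightarrow> s \<le> p \<and> p < s + 2 * size t"
  using edges_bounds[of e s t] by auto

lemma edges_subset: "e \<in> edges s t \<Longrightarrow> e \<subseteq> {s..<s + 2 * size t}"
  using edges_mem_bounds by fastforce

lemma edges_shift: "image (\<lambda>x. x + c) ` edges s t = edges (s + c) t"
proof (induction t arbitrary: s)
  case (Arch t1 t2)
  show ?case
    using Arch.IH(1)[of "s + 1"] Arch.IH(2)[of "s + 2 + 2 * size t1"]
    by (simp add: image_Un add_ac)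
qed simp

text \<open>\<open>is_matching\<close> on an arbitrary interval, so that inductions can pass to the
  parts under and behind the first arc.\<close>

definition matching_on :: "nat \<Rightarrow> nat \<Rightarrow> nat set set \<Rightarrow> bool" where
  "matching_on s n M \<longleftrightarrow>
     (\<forall>e\<in>M. \<exists>a b. e = {a, b} \<and> s \<le> a \<and> a < b \<and> b < s + n) \<and>
     (\<forall>p. s \<le> p \<longrightarrow> p < s + n \<longrightarrow> (\<exists>!e. e \<in> M \<and> p \<in> e)) \<and>
     (\<forall>a b c d. {a, b} \<in> M \<longrightarrow> {c, d} \<in> M \<longrightarrow> \<not> crosses a b c d)"

lemma matching_on_edge:
  "matching_on s n M \<Longrightarrow> e \<in> M \<Longrightarrow> \<exists>a b. e = {a, b} \<and> s \<le> a \<and> a < b \<and> b < s + n"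
  unfolding matching_on_def by blast

lemma matching_on_ex1:
  "matching_on s n M \<Longrightarrow> s \<le> p \<Longrightarrow> p < s + n \<Longrightarrow> \<exists>!e. e \<in> M \<and> p \<in> e"
  unfolding matching_on_def by presburger

lemma matching_on_not_crosses:
  "matching_on s n M \<Longrightarrow> {a, b} \<in> M \<Longrightarrow> {c, d} \<in> M \<Longrightarrow> \<not> crosses a b c d"
  unfolding matching_on_def by presburger

lemma is_matching_iff: "is_matching n M \<longleftrightarrow> matching_on 0 n M"
  by (simp add: is_matching_def matching_on_def)

lemma matching_on_edges: "matching_on s (2 * size t) (edges s t)"
proof (induction t arbitrary: s)
  case Empty
  then show ?case by (simp add: matching_on_def)
next
  case (Arch t1 t2)
  let ?q = "s + 1 + 2 * size t1"
  let ?A = "edges (s + 1) t1" and ?B = "edges (s + 2 + 2 * size t1) t2"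
  have A: "s < p \<and> p < ?q" if "e \<in> ?A" "p \<in> e" for e p
    using edges_mem_bounds[OF that] by auto
  have B: "?q < p \<and> p < s + 2 * size (Arch t1 t2)" if "e \<in> ?B" "p \<in> e" for e p
    using edges_mem_bounds[OF that] by auto
  show ?case
    unfolding matching_on_def
  proof (intro conjI allI impI ballI)
    fix e assume "e \<in> edges s (Arch t1 t2)"
    then show "\<exists>a b. e = {a, b} \<and> s \<le> a \<and> a < b \<and> b < s + 2 * size (Arch t1 t2)"
      by (rule edges_bounds)
  next
    fix p assume p: "s \<le> p" "p < s + 2 * size (Arch t1 t2)"
    consider "p = s \<or> p = ?q" | "s < p" "p < ?q" | "?q < p" using p(1) by linarith
    then show "\<exists>!e. e \<in> edges s (Arch t1 t2) \<and> p \<in> e"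
    proof cases
      case 1
      show ?thesis
      proof (rule ex1I[of _ "{s, ?q}"])
        fix e' assume "e' \<in> edges s (Arch t1 t2) \<and> p \<in> e'"
        then show "e' = {s, ?q}" using 1 A[of e' p] B[of e' p] by auto
      qed (use 1 in auto)
    next
      case 2
      then have "\<exists>!e. e \<in> ?A \<and> p \<in> e"
        using matching_on_ex1[OF Arch.IH(1)[of "s + 1"], of p] by simp
      then obtain e where e: "e \<in> ?A" "p \<in> e" "\<And>e'. e' \<in> ?A \<Longrightarrow> p \<in> e' \<Longrightarrow> e' = e"
        by blast
      show ?thesis
      proof (rule ex1I[of _ e])
        fix e' assume "e' \<in> edges s (Arch t1 t2) \<and> p \<in> e'"
        then show "e' = e" using e(3)[of e'] 2 B[of e' p] by auto
      qed (use e(1,2) in auto)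
    next
      case 3
      then have "\<exists>!e. e \<in> ?B \<and> p \<in> e"
        using matching_on_ex1[OF Arch.IH(2)[of "s + 2 + 2 * size t1"], of p] p(2) by simp
      then obtain e where e: "e \<in> ?B" "p \<in> e" "\<And>e'. e' \<in> ?B \<Longrightarrow> p \<in> e' \<Longrightarrow> e' = e"
        by blast
      show ?thesis
      proof (rule ex1I[of _ e])
        fix e' assume "e' \<in> edges s (Arch t1 t2) \<and> p \<in> e'"
        then show "e' = e" using e(3)[of e'] 3 A[of e' p] by auto
      qed (use e(1,2) in auto)
    qed
  next
    fix a b c d
    assume ab: "{a, b} \<in> edges s (Arch t1 t2)" and cd: "{c, d} \<in> edges s (Arch t1 t2)"
    have *: "{x, y} = {s, ?q} \<or> {x, y} \<in> ?A \<and> s < x \<and> s < y \<and> x < ?q \<and> y < ?q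
        \<or> {x, y} \<in> ?B \<and> ?q < x \<and> ?q < y" if "{x, y} \<in> edges s (Arch t1 t2)" for x y
      using that A[of "{x, y}" x] A[of "{x, y}" y] B[of "{x, y}" x] B[of "{x, y}" y] by auto
    show "\<not> crosses a b c d"
    proof
      assume cr: "crosses a b c d"
      then have o: "a < c" "c < b" "b < d" by (auto simp: crosses_def)
      have nA: "{a, b} \<notin> ?A \<or> {c, d} \<notin> ?A"
        using matching_on_not_crosses[OF Arch.IH(1)] cr by metis
      have nB: "{a, b} \<notin> ?B \<or> {c, d} \<notin> ?B"
        using matching_on_not_crosses[OF Arch.IH(2)] cr by metis
      from *[OF ab] show False
      proof (elim disjE conjE)
        assume "{a, b} = {s, ?q}"
        with o have "a = s" "b = ?q" by (auto simp: doubleton_eq_iff)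
        with *[OF cd] o show False by (auto simp: doubleton_eq_iff)
      next
        assume "{a, b} \<in> ?A" "s < a" "b < ?q"
        with *[OF cd] nA o show False by (auto simp: doubleton_eq_iff)
      next
        assume "{a, b} \<in> ?B" "?q < a"
        with *[OF cd] nB o show False by (auto simp: doubleton_eq_iff)
      qed
    qed
  qed
qed

lemma matching_on_sub:
  assumes M: "matching_on s n M"
    and sub: "s \<le> s'" "s' + n' \<le> s + n"
    and closed: "\<And>e p. e \<in> M \<Longrightarrow> p \<in> e \<Longrightarrow> s' \<le> p \<Longrightarrow> p < s' + n' \<Longrightarrow> e \<subseteq> {s'..<s' + n'}"
  shows "matching_on s' n' {e \<in> M. e \<subseteq> {s'..<s' + n'}}"
  unfolding matching_on_def
proof (intro conjI allI impI ballI)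
  fix e assume e: "e \<in> {e \<in> M. e \<subseteq> {s'..<s' + n'}}"
  then obtain a b where "e = {a, b}" "a < b" using matching_on_edge[OF M, of e] by auto
  with e show "\<exists>a b. e = {a, b} \<and> s' \<le> a \<and> a < b \<and> b < s' + n'" by auto
next
  fix p assume p: "s' \<le> p" "p < s' + n'"
  then have "\<exists>!e. e \<in> M \<and> p \<in> e" using matching_on_ex1[OF M, of p] sub by simp
  then obtain e where e: "e \<in> M" "p \<in> e" "\<And>e'. e' \<in> M \<Longrightarrow> p \<in> e' \<Longrightarrow> e' = e" by blast
  show "\<exists>!e. e \<in> {e \<in> M. e \<subseteq> {s'..<s' + n'}} \<and> p \<in> e"
    by (rule ex1I[of _ e]) (use e(1,2) e(3) closed[OF e(1,2) p] in blast)+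
next
  fix a b c d
  assume "{a, b} \<in> {e \<in> M. e \<subseteq> {s'..<s' + n'}}" "{c, d} \<in> {e \<in> M. e \<subseteq> {s'..<s' + n'}}"
  then show "\<not> crosses a b c d" using matching_on_not_crosses[OF M] by blast
qed

text \<open>Since arcs do not cross, every edge other than the one \<open>{s, q}\<close> at the
  first point lies strictly under it or strictly behind it. Both parts are matchings of shorter
  intervals, and induction turns them into the two subtrees.\<close>

lemma matching_on_imp_edges:
  "matching_on s n M \<Longrightarrow> \<exists>t. 2 * size t = n \<and> M = edges s t"
proof (induction n arbitrary: s M rule: less_induct)
  case (less n)
  show ?case
  proof (cases "n = 0")
    case True
    have "M = {}" using matching_on_edge[OF less.prems] True by fastforce
    with True show ?thesis by (intro exI[of _ Empty]) simp
  next
    case False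
    have ex: "\<exists>!e. e \<in> M \<and> p \<in> e" if "s \<le> p" "p < s + n" for p
      using matching_on_ex1[OF less.prems that] .
    from ex[of s] False obtain e where e: "e \<in> M" "s \<in> e" by auto
    then obtain a b where "e = {a, b}" "s \<le> a" "a < b" "b < s + n"
      using matching_on_edge[OF less.prems] by blast
    with e obtain q where q: "{s, q} \<in> M" "s < q" "q < s + n" by auto
    define m where "m = q - s - 1"
    define m' where "m' = s + n - q - 1"
    have qm: "q = s + 1 + m" and nm: "n = m + m' + 2" using q by (auto simp: m_def m'_def)
    have split: "e = {s, q} \<or> e \<subseteq> {s + 1..<s + 1 + m} \<or> e \<subseteq> {q + 1..<q + 1 + m'}"
      if eM: "e \<in> M" for e
    proof -
      obtain a b where ab: "e = {a, b}" "s \<le> a" "a < b" "b < s + n"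
        using matching_on_edge[OF less.prems eM] by blast
      have nc: "\<not> crosses s q a b"
        using matching_on_not_crosses[OF less.prems q(1), of a b] eM ab(1) by simp
      show ?thesis
      proof (cases "s \<in> e \<or> q \<in> e")
        case True
        then have "e = {s, q}" using ex[of s] ex[of q] q eM by auto
        then show ?thesis ..
      next
        case False
        then have "s < a" "a \<noteq> q" "b \<noteq> q" using ab by auto
        with nc ab have "b < q \<or> q < a" by (auto simp: crosses_def)
        then show ?thesis
        proof
          assume "b < q"
          with ab qm \<open>s < a\<close> have "e \<subseteq> {s + 1..<s + 1 + m}" by simp
          then show ?thesis by blast
        next
          assume "q < a"
          with ab qm nm have "e \<subseteq> {q + 1..<q + 1 + m'}" by simp
          then show ?thesis by blast
        qed
      qed
    qed
    let ?A = "{e \<in> M. e \<subseteq> {s + 1..<s + 1 + m}}"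
    let ?B = "{e \<in> M. e \<subseteq> {q + 1..<q + 1 + m'}}"
    have MA: "matching_on (s + 1) m ?A"
    proof (rule matching_on_sub[OF less.prems])
      fix e p assume "e \<in> M" "p \<in> e" "s + 1 \<le> p" "p < s + 1 + m"
      moreover from this have "p \<noteq> s" "p \<noteq> q" "p \<notin> {q + 1..<q + 1 + m'}" using qm by auto
      ultimately show "e \<subseteq> {s + 1..<s + 1 + m}" using split[of e] by blast
    qed (use nm in auto)
    obtain t1 where t1: "2 * size t1 = m" "?A = edges (s + 1) t1"
    proof -
      have "m < n" using nm by simp
      from less.IH[OF this MA] show ?thesis using that by blast
    qed
    have MB: "matching_on (q + 1) m' ?B"
    proof (rule matching_on_sub[OF less.prems])
      fix e p assume "e \<in> M" "p \<in> e" "q + 1 \<le> p" "p < q + 1 + m'"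
      moreover from this have "p \<noteq> s" "p \<noteq> q" "p \<notin> {s + 1..<s + 1 + m}" using qm by auto
      ultimately show "e \<subseteq> {q + 1..<q + 1 + m'}" using split[of e] by blast
    qed (use nm qm in auto)
    obtain t2 where t2: "2 * size t2 = m'" "?B = edges (q + 1) t2"
    proof -
      have "m' < n" using nm by simp
      from less.IH[OF this MB] show ?thesis using that by blast
    qed
    have "M = insert {s, q} (?A \<union> ?B)" using split q(1) by blast
    then have "M = edges s (Arch t1 t2)" using t1 t2 qm by simp
    moreover have "2 * size (Arch t1 t2) = n" using t1 t2 nm by simp
    ultimately show ?thesis by (intro exI[of _ "Arch t1 t2"] conjI)
  qed
qed

lemma edge_first: "{s, q} \<in> edges s t \<Longrightarrow> \<exists>a b. t = Arch a b \<and> q = s + 1 + 2 * size a"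
proof (cases t)
  case (Arch a b)
  assume "{s, q} \<in> edges s t"
  moreover have "{s, q} \<notin> edges (s + 1) a" "{s, q} \<notin> edges (s + 2 + 2 * size a) b"
    using edges_mem_bounds[of "{s, q}" "s + 1" a s]
      edges_mem_bounds[of "{s, q}" "s + 2 + 2 * size a" b s] by auto
  ultimately show ?thesis using Arch by (auto simp: doubleton_eq_iff)
qed simp

text \<open>The edge at \<open>s\<close> reveals the size of the first subtree and hence both
  intervals; restricting the edge set to each interval recovers the edges of each subtree.\<close>

lemma edges_inj: "edges s t = edges s t' \<Longrightarrow> t = t'"
proof (induction t arbitrary: s t')
  case Empty
  then show ?case by (cases t') auto
next
  case (Arch a b)
  have "{s, s + 1 + 2 * size a} \<in> edges s t'" using Arch.prems[symmetric] by simp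
  from edge_first[OF this] obtain a' b' where t': "t' = Arch a' b'" and sz: "size a' = size a"
    by auto
  have L: "edges (s + 1) x = {e \<in> edges s (Arch x y). e \<subseteq> {s + 1..<s + 1 + 2 * size x}}" for x y
  proof -
    have "e \<notin> edges (s + 2 + 2 * size x) y" if "e \<subseteq> {s + 1..<s + 1 + 2 * size x}" for e
    proof
      assume e: "e \<in> edges (s + 2 + 2 * size x) y"
      then obtain p where "p \<in> e" using edges_bounds[OF e] by auto
      then show False using that edges_mem_bounds[OF e, of p] by auto
    qed
    then show ?thesis using edges_subset[of _ "s + 1" x] by auto
  qed
  have R: "edges (s + 2 + 2 * size x) y = {e \<in> edges s (Arch x y). e \<subseteq> {s + 2 + 2 * size x..}}" for x y
  proof -
    have "e \<notin> edges (s + 1) x" if "e \<subseteq> {s + 2 + 2 * size x..}" for e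
    proof
      assume e: "e \<in> edges (s + 1) x"
      then obtain p where "p \<in> e" using edges_bounds[OF e] by auto
      then show False using that edges_mem_bounds[OF e, of p] by auto
    qed
    then show ?thesis using edges_subset[of _ "s + 2 + 2 * size x" y] by fastforce
  qed
  note eq = Arch.prems[unfolded t']
  have "edges (s + 1) a = edges (s + 1) a'"
    using L[where x = a and y = b] L[where x = a' and y = b'] unfolding eq sz by (rule trans[OF _ sym])
  moreover have "edges (s + 2 + 2 * size a) b = edges (s + 2 + 2 * size a) b'"
    using R[where x = a and y = b] R[where x = a' and y = b'] unfolding eq sz by (rule trans[OF _ sym])
  ultimately show ?case using Arch.IH t' by blast
qed

section \<open>Block removal\<close>

text \<open>A bottom-up tree automaton: \<open>q\<close> is the state of a single vertex, and
  \<open>f\<close> attaches a leftmost child to a root.\<close>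

primrec run :: "('s \<Rightarrow> 's \<Rightarrow> 's) \<Rightarrow> 's \<Rightarrow> arcs \<Rightarrow> 's" where
  "run f q Empty = q"
| "run f q (Arch a b) = f (run f q a) (run f q b)"

text \<open>Deletion of two nested arcs on four consecutive points, the first being \<open>p\<close>
  counted from the start of the interval. In the tree, a child that is a single edge
  disappears.\<close>

inductive excise :: "nat \<Rightarrow> arcs \<Rightarrow> arcs \<Rightarrow> bool" where
  here: "excise 0 (Arch arch1 t) t"
| inside: "excise p a a' \<Longrightarrow> excise (p + 1) (Arch a b) (Arch a' b)"
| right: "excise p b b' \<Longrightarrow> excise (p + 2 + 2 * size a) (Arch a b) (Arch a b')"

lemma excise_size: "excise p t t' \<Longrightarrow> size t = size t' + 2 \<and> p \<le> 2 * size t'"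
  by (induction rule: excise.induct) auto

lemma image_edges_cong:
  assumes "\<And>x. s \<le> x \<Longrightarrow> x < s + 2 * size t \<Longrightarrow> h x = x + c"
  shows "image h ` edges s t = edges (s + c) t"
proof -
  have "image h ` edges s t = image (\<lambda>x. x + c) ` edges s t"
    using edges_mem_bounds assms by (intro image_cong refl) blast
  then show ?thesis by (simp add: edges_shift)
qed

text \<open>The map reopens a gap of four points at \<open>s + p\<close>. A subtree away from the
  gap lies on one side of it and is translated by 0 or 4; the other one is covered by
  induction.\<close>

lemma edges_excise:
  "excise p t t' \<Longrightarrow> edges s t = {{s + p, s + p + 3}, {s + p + 1, s + p + 2}} \<union>
     image (\<lambda>x. if x < s + p then x else x + 4) ` edges s t'"
proof (induction arbitrary: s rule: excise.induct)
  case (here t)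
  have "image (\<lambda>x. if x < s + 0 then x else x + 4) ` edges s t = edges (s + 4) t"
    by (rule image_edges_cong) simp
  then show ?case by (simp add: eval_nat_numeral insert_commute)
next
  case (inside p a a' b)
  let ?h = "\<lambda>x. if x < s + (p + 1) then x else x + 4"
  note sz = excise_size[OF inside.hyps]
  have "edges (s + 1) a = {{s + (p + 1), s + (p + 1) + 3}, {s + (p + 1) + 1, s + (p + 1) + 2}} \<union>
      image ?h ` edges (s + 1) a'"
    using inside.IH[of "s + 1"] by (simp add: add_ac)
  moreover have "edges (s + 2 + 2 * size a) b = image ?h ` edges (s + 2 + 2 * size a') b"
    by (subst image_edges_cong[where c = 4]) (use sz in \<open>auto simp: eval_nat_numeral\<close>)
  moreover have "?h ` {s, s + 1 + 2 * size a'} = {s, s + 1 + 2 * size a}"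
    using sz by auto
  ultimately show ?case by (simp only: edges.simps image_insert image_Un Un_insert_left Un_assoc)
      (simp only: insert_commute Un_insert_right Un_insert_left Un_empty_left)
next
  case (right p b b' a)
  let ?r = "p + 2 + 2 * size a"
  let ?h = "\<lambda>x. if x < s + ?r then x else x + 4"
  have "edges (s + 2 + 2 * size a) b = {{s + ?r, s + ?r + 3}, {s + ?r + 1, s + ?r + 2}} \<union>
      image ?h ` edges (s + 2 + 2 * size a) b'"
    using right.IH[of "s + 2 + 2 * size a"] by (simp add: add_ac)
  moreover have "edges (s + 1) a = image ?h ` edges (s + 1) a"
    by (subst image_edges_cong[where c = 0]) auto
  moreover have "?h ` {s, s + 1 + 2 * size a} = {s, s + 1 + 2 * size a}"
    by auto
  ultimately show ?case by (simp only: edges.simps image_insert image_Un) blast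
qed

text \<open>An arc over exactly two points forces these to be joined, so the outer edge alone
  locates the block.\<close>

lemma ex_excise: "{s + p, s + p + 3} \<in> edges s t \<Longrightarrow> \<exists>t'. excise p t t'"
proof (induction t arbitrary: s p)
  case Empty
  then show ?case by simp
next
  case (Arch a b)
  from Arch.prems consider "{s + p, s + p + 3} = {s, s + 1 + 2 * size a}"
    | "{s + p, s + p + 3} \<in> edges (s + 1) a" | "{s + p, s + p + 3} \<in> edges (s + 2 + 2 * size a) b"
    by auto
  then show ?case
  proof cases
    case 1
    then have "p = 0" "size a = Suc 0" by (auto simp: doubleton_eq_iff)
    then show ?thesis using excise.here by (auto simp: size_arcs_1)
  next
    case 2
    then have "1 \<le> p" using edges_mem_bounds[OF 2, of "s + p"] by simp
    then obtain p' where "p = p' + 1" by (metis add.commute le_Suc_ex)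
    then show ?thesis using Arch.IH(1)[of "s + 1" p'] 2 excise.inside by (fastforce simp: add_ac)
  next
    case 3
    then have "2 + 2 * size a \<le> p" using edges_mem_bounds[OF 3, of "s + p"] by simp
    then obtain p' where p': "p = p' + 2 + 2 * size a"
      by (metis add.commute add.assoc le_Suc_ex)
    then have "{s + 2 + 2 * size a + p', s + 2 + 2 * size a + p' + 3} \<in> edges (s + 2 + 2 * size a) b"
      using 3 by (simp add: add_ac)
    then show ?thesis using Arch.IH(2) excise.right unfolding p' by blast
  qed
qed

text \<open>The state of \<open>arch1\<close> is \<open>f q q\<close>; attaching a child in this
  state changes nothing.\<close>

lemma run_excise:
  assumes "\<And>x. f (f q q) x = x"
  shows "excise p t t' \<Longrightarrow> run f q t = run f q t'"
  by (induction rule: excise.induct) (auto simp: assms)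

text \<open>The last three rules are the blocks that wrap around the point 0.\<close>

inductive removal :: "nat \<Rightarrow> arcs \<Rightarrow> arcs \<Rightarrow> bool" where
  "excise p t t' \<Longrightarrow> removal p t t'"
| "removal (2 * size t + 1) (Arch t arch1) t"
| "removal (2 * size t + 2) (Arch (Arch t Empty) Empty) t"
| "removal (2 * size t + 3) (Arch Empty (Arch t Empty)) t"

lemma removal_size: "removal i t t' \<Longrightarrow> size t = size t' + 2 \<and> i < 2 * size t"
  by (induction rule: removal.induct) (use excise_size in fastforce)+

text \<open>\<open>g\<close> puts the points of \<open>M\<close> back around the four block points,
  and \<open>relabel\<close> undoes it. Edges in the image of \<open>M\<close> are nonempty and
  avoid the block points, so deleting the block leaves exactly them.\<close>

lemma remove_block_eqI:
  assumes N: "N = block_at n i \<union> image g ` M"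
    and M: "\<And>e. e \<in> M \<Longrightarrow> e \<noteq> {} \<and> e \<subseteq> {..<m}"
    and g: "\<And>x. x < m \<Longrightarrow> g x \<notin> block_pts n i \<and> relabel (block_pts n i) (g x) = x"
  shows "remove_block n N i = M"
proof -
  have "g ` e \<notin> block_at n i" if "e \<in> M" for e
  proof
    assume "g ` e \<in> block_at n i"
    then have "g ` e \<subseteq> block_pts n i" by (auto simp: block_at_def block_pts_def)
    with M[OF that] g show False by blast
  qed
  then have "N - block_at n i = image g ` M" using N by auto
  then have "remove_block n N i = (\<lambda>e. relabel (block_pts n i) ` g ` e) ` M"
    unfolding remove_block_def by (simp only: image_image)
  also have "\<dots> = (\<lambda>e. e) ` M"
  proof (rule image_cong[OF refl])
    fix e assume "e \<in> M"
    with M have "e \<subseteq> {..<m}" by blast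
    then have "relabel (block_pts n i) ` g ` e = (\<lambda>x. x) ` e"
      unfolding image_image by (intro image_cong refl) (use g in auto)
    then show "relabel (block_pts n i) ` g ` e = e" by simp
  qed
  finally show ?thesis by simp
qed

text \<open>This and the next two lemmas evaluate the residues for blocks that contain both
  \<open>n - 1\<close> and 0.\<close>

lemma block_wrap1:
  assumes "i + 3 = n"
  shows "block_at n i = {{i, 0}, {i + 1, i + 2}}" "block_pts n i = {i, i + 1, i + 2, 0}"
  using assms by (auto simp: block_at_def block_pts_def)

lemma block_wrap2:
  assumes "i + 2 = n" "n \<ge> 4"
  shows "block_at n i = {{i, 1}, {i + 1, 0}}" "block_pts n i = {i, i + 1, 0, 1}"
proof -
  have "i + 3 = n + 1" using assms(1) by simp
  then have "(i + 3) mod n = 1" using assms(2) by (simp only: mod_add_self1) simp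
  then show "block_at n i = {{i, 1}, {i + 1, 0}}" "block_pts n i = {i, i + 1, 0, 1}"
    unfolding block_at_def block_pts_def using assms(1) by simp_all
qed

lemma block_wrap3:
  assumes "i + 1 = n" "n \<ge> 4"
  shows "block_at n i = {{i, 2}, {0, 1}}" "block_pts n i = {i, 0, 1, 2}"
proof -
  have "i + 3 = n + 2" "i + 2 = n + 1" using assms(1) by simp_all
  then have "(i + 3) mod n = 2" "(i + 2) mod n = 1" using assms(2) by (simp_all only: mod_add_self1) simp_all
  then show "block_at n i = {{i, 2}, {0, 1}}" "block_pts n i = {i, 0, 1, 2}"
    unfolding block_at_def block_pts_def using assms(1) by simp_all
qed

text \<open>The reinsertion map jumps by 4 at \<open>i\<close> for an ordinary block. For a wrapped
  block it is the translation by 1, 2 or 3, the number of block points at the start of the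
  interval.\<close>

lemma removal_edges:
  assumes "removal i t t'"
  shows "block_at (2 * size t) i \<subseteq> edges 0 t \<and> remove_block (2 * size t) (edges 0 t) i = edges 0 t'"
proof -
  have bounds: "e \<noteq> {} \<and> e \<subseteq> {..<2 * size t'}" if "e \<in> edges 0 t'" for e t'
    using edges_bounds[OF that] by auto
  have "\<exists>g. edges 0 t = block_at (2 * size t) i \<union> image g ` edges 0 t' \<and>
      (\<forall>x<2 * size t'. g x \<notin> block_pts (2 * size t) i \<and> relabel (block_pts (2 * size t) i) (g x) = x)"
    using assms
  proof cases
    case 1
    let ?g = "\<lambda>x. if x < i then x else x + 4"
    note sz = excise_size[OF 1]
    have B: "block_at (2 * size t) i = {{i, i + 3}, {i + 1, i + 2}}"
      "block_pts (2 * size t) i = {i, i + 1, i + 2, i + 3}"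
      using sz by (auto simp: block_at_def block_pts_def)
    have "relabel {i, i + 1, i + 2, i + 3} (?g x) = x" for x
    proof (cases "x < i")
      case True
      then have "{r \<in> {i, i + 1, i + 2, i + 3}. r < x} = {}" by auto
      with True show ?thesis by (simp only: relabel_def if_True) simp
    next
      case False
      then have "{r \<in> {i, i + 1, i + 2, i + 3}. r < x + 4} = {i, i + 1, i + 2, i + 3}" by auto
      with False show ?thesis by (simp only: relabel_def if_False) simp
    qed
    then show ?thesis using edges_excise[OF 1, of 0] unfolding B
      by (intro exI[of _ ?g]) auto
  next
    case 2
    have B: "block_at (2 * size t) i = {{i, 0}, {i + 1, i + 2}}"
      "block_pts (2 * size t) i = {i, i + 1, i + 2, 0}"
      by (rule block_wrap1; use 2 in simp)+
    have "relabel {i, i + 1, i + 2, 0} (x + 1) = x" if "x < 2 * size t'" for x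
    proof -
      have "{r \<in> {i, i + 1, i + 2, 0}. r < x + 1} = {0}" using that 2 by auto
      then show ?thesis by (simp only: relabel_def) simp
    qed
    moreover have "edges 0 t = {{i, 0}, {i + 1, i + 2}} \<union> image (\<lambda>x. x + 1) ` edges 0 t'"
      unfolding edges_shift using 2 by (auto simp: insert_commute)
    ultimately show ?thesis using 2(1) unfolding B
      by (intro exI[of _ "\<lambda>x. x + 1"]) auto
  next
    case 3
    have B: "block_at (2 * size t) i = {{i, 1}, {i + 1, 0}}"
      "block_pts (2 * size t) i = {i, i + 1, 0, 1}"
      by (rule block_wrap2; use 3 in simp)+
    have "relabel {i, i + 1, 0, 1} (x + 2) = x" if "x < 2 * size t'" for x
    proof -
      have "{r \<in> {i, i + 1, 0, 1}. r < x + 2} = {0, 1}" using that 3 by auto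
      then show ?thesis by (simp only: relabel_def) simp
    qed
    moreover have "edges 0 t = {{i, 1}, {i + 1, 0}} \<union> image (\<lambda>x. x + 2) ` edges 0 t'"
      unfolding edges_shift using 3 by (auto simp: insert_commute eval_nat_numeral)
    ultimately show ?thesis using 3(1) unfolding B
      by (intro exI[of _ "\<lambda>x. x + 2"]) auto
  next
    case 4
    have B: "block_at (2 * size t) i = {{i, 2}, {0, 1}}"
      "block_pts (2 * size t) i = {i, 0, 1, 2}"
      by (rule block_wrap3; use 4 in simp)+
    have "relabel {i, 0, 1, 2} (x + 3) = x" if "x < 2 * size t'" for x
    proof -
      have "{r \<in> {i, 0, 1, 2}. r < x + 3} = {0, 1, 2}" using that 4 by auto
      then show ?thesis by (simp only: relabel_def) simp
    qed
    moreover have "edges 0 t = {{i, 2}, {0, 1}} \<union> image (\<lambda>x. x + 3) ` edges 0 t'"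
      unfolding edges_shift using 4 by (auto simp: insert_commute eval_nat_numeral)
    ultimately show ?thesis using 4(1) unfolding B
      by (intro exI[of _ "\<lambda>x. x + 3"]) auto
  qed
  then obtain g where g: "edges 0 t = block_at (2 * size t) i \<union> image g ` edges 0 t'"
      "\<And>x. x < 2 * size t' \<Longrightarrow>
        g x \<notin> block_pts (2 * size t) i \<and> relabel (block_pts (2 * size t) i) (g x) = x"
    by blast
  have "remove_block (2 * size t) (edges 0 t) i = edges 0 t'"
  proof (rule remove_block_eqI[where g = g and m = "2 * size t'"])
    show "edges 0 t = block_at (2 * size t) i \<union> image g ` edges 0 t'" by (fact g(1))
  qed (fact bounds, fact g(2))
  then show ?thesis using g(1) by blast
qed

text \<open>If the block wraps, the edge at 0 fixes the sizes of both subtrees of the root, and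
  where needed the other block edge fixes the next level.\<close>

lemma ex_removal:
  assumes i: "i < 2 * size t" and sz: "size t \<ge> 2" and B: "block_at (2 * size t) i \<subseteq> edges 0 t"
  shows "\<exists>t'. removal i t t'"
proof -
  let ?n = "2 * size t"
  consider "i + 3 < ?n" | "i + 3 = ?n" | "i + 2 = ?n" | "i + 1 = ?n" using i by linarith
  then show ?thesis
  proof cases
    case 1
    then have "{0 + i, 0 + i + 3} \<in> edges 0 t" using B by (simp add: block_at_def)
    then show ?thesis using ex_excise removal.intros(1) by blast
  next
    case 2
    then have "{0, i} \<in> edges 0 t" using B by (simp add: block_at_def insert_commute)
    from edge_first[OF this] obtain a b where t: "t = Arch a b" "i = 1 + 2 * size a" by auto
    with 2 have "size b = Suc 0" by simp
    then show ?thesis using t removal.intros(2)[of a] by (auto simp: size_arcs_1 add_ac)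
  next
    case 3
    have "{0, i + 1} \<in> edges 0 t" "{1, i} \<in> edges 0 t"
      using B block_wrap2[OF 3] sz by (auto simp: insert_commute)
    from edge_first[OF this(1)] obtain a b where t: "t = Arch a b" "i = 2 * size a" by auto
    with 3 have b: "b = Empty" by simp
    with \<open>{1, i} \<in> edges 0 t\<close> t have "{1, i} \<in> edges 1 a"
      using 3 sz by (auto simp: doubleton_eq_iff)
    from edge_first[OF this] obtain c d where "a = Arch c d" "i = 2 + 2 * size c" by auto
    with t b show ?thesis using removal.intros(3)[of c] by (auto simp: add_ac)
  next
    case 4
    have "{0, 1} \<in> edges 0 t" "{2, i} \<in> edges 0 t"
      using B block_wrap3[OF 4] sz by (auto simp: insert_commute)
    from edge_first[OF this(1)] obtain b where t: "t = Arch Empty b" by auto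
    have "i \<noteq> 0" "i \<noteq> 1" using 4 sz by auto
    with \<open>{2, i} \<in> edges 0 t\<close> t have "{2, i} \<in> edges 2 b"
      by (auto simp: doubleton_eq_iff eval_nat_numeral)
    from edge_first[OF this] obtain c d where "b = Arch c d" "i = 3 + 2 * size c" by auto
    with t 4 show ?thesis using removal.intros(4)[of c] by (auto simp: add_ac)
  qed
qed

section \<open>Recognising L-matchings\<close>

text \<open>The greedy matching of a rooted tree, built from the leaves upwards, joins every vertex to one of its
  unmatched children, if it has any. The states record its outcome.
  \<open>NF\<close>: only the root is unmatched; \<open>NM\<close>: the matching is perfect; \<open>ND\<close>: the root is matched and exactly
  one other vertex is not; \<open>NE\<close>: the root and exactly one other vertex are unmatched;
  \<open>NB\<close>: none of these. \<open>near_step x y\<close> attaches a child in state \<open>x\<close> to a root in state \<open>y\<close>.\<close>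

datatype near = NF | NM | ND | NE | NB

fun near_step :: "near \<Rightarrow> near \<Rightarrow> near" where
  "near_step NM s = s"
| "near_step NF NF = NM"
| "near_step NF NM = ND"
| "near_step NF NE = ND"
| "near_step ND NM = ND"
| "near_step ND NF = NE"
| "near_step NE NF = ND"
| "near_step _ _ = NB"

text \<open>The analogue for trees that contain a claw, that is a vertex with three neighbours, such that
  the rest is perfectly matched. \<open>CF\<close> and \<open>CM\<close> are as above; \<open>CR\<close>: the root has exactly two
  unmatched children, so it is a claw centre whose third leaf is still missing;
  \<open>CP\<close>: claw and matching are complete; \<open>CQ\<close>: complete except that the root is unmatched.\<close>

datatype claw = CF | CM | CR | CP | CQ | CB

fun claw_step :: "claw \<Rightarrow> claw \<Rightarrow> claw" where
  "claw_step CM s = s"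
| "claw_step CF CF = CM"
| "claw_step CF CM = CR"
| "claw_step CF CR = CP"
| "claw_step CF CQ = CP"
| "claw_step CR CF = CP"
| "claw_step CP CM = CP"
| "claw_step CP CF = CQ"
| "claw_step CQ CF = CP"
| "claw_step _ _ = CB"

text \<open>\<open>NF\<close> and \<open>ND\<close> distinguish whether the one unmatched vertex is
  the root. The single vertex \<open>Empty\<close> also ends in \<open>NF\<close> but represents no
  L-matching.\<close>

definition accepted :: "arcs \<Rightarrow> bool" where
  "accepted t \<longleftrightarrow> t \<noteq> Empty \<and> run near_step NF t \<in> {NF, ND} \<or> run claw_step CF t = CP"

text \<open>Predecessors of each state other than \<open>NB\<close>, for tracing runs
  backwards.\<close>

lemma near_step_simps [simp]:
  "near_step x y = NF \<longleftrightarrow> x = NM \<and> y = NF"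
  "near_step x y = NM \<longleftrightarrow> x = NM \<and> y = NM \<or> x = NF \<and> y = NF"
  "near_step x y = NE \<longleftrightarrow> x = NM \<and> y = NE \<or> x = ND \<and> y = NF"
  "near_step x y = ND \<longleftrightarrow> x = NM \<and> y = ND \<or> x = NF \<and> (y = NM \<or> y = NE) \<or>
     x = ND \<and> y = NM \<or> x = NE \<and> y = NF"
  by (cases x; cases y; simp)+

lemma claw_step_simps [simp]:
  "claw_step x y = CF \<longleftrightarrow> x = CM \<and> y = CF"
  "claw_step x y = CM \<longleftrightarrow> x = CM \<and> y = CM \<or> x = CF \<and> y = CF"
  "claw_step x y = CR \<longleftrightarrow> x = CM \<and> y = CR \<or> x = CF \<and> y = CM"
  "claw_step x y = CQ \<longleftrightarrow> x = CM \<and> y = CQ \<or> x = CP \<and> y = CF"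
  "claw_step x y = CP \<longleftrightarrow> x = CM \<and> y = CP \<or> x = CF \<and> (y = CR \<or> y = CQ) \<or>
     x = CP \<and> y = CM \<or> (x = CR \<or> x = CQ) \<and> y = CF"
  by (cases x; cases y; simp)+

text \<open>The tree has \<open>size t + 1\<close> vertices, of which one is unmatched in
  \<open>NF\<close> and \<open>ND\<close>, none in \<open>NM\<close>, and two in
  \<open>NE\<close>.\<close>

lemma near_parity:
  "(run near_step NF t \<in> {NF, ND} \<longrightarrow> even (size t)) \<and>
   (run near_step NF t \<in> {NM, NE} \<longrightarrow> odd (size t))"
  by (induction t) auto

text \<open>Again by counting vertices: a complete claw covers four of them, and in
  \<open>CR\<close> the root and two children are still unpaired.\<close>

lemma claw_parity:
  "(run claw_step CF t \<in> {CF, CR, CQ} \<longrightarrow> even (size t)) \<and>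
   (run claw_step CF t \<in> {CM, CP} \<longrightarrow> odd (size t))"
  by (induction t) auto

text \<open>Ordinary blocks leave the states unchanged. In the three wrapped shapes a pendant path
  of length 2 is joined to the root of \<open>t'\<close> and the new root lies on that path; the
  transition tables settle these.\<close>

lemma accepted_removal:
  "removal i t t' \<Longrightarrow> accepted t' \<Longrightarrow> accepted t"
proof (induction rule: removal.induct)
  case (1 p t t')
  have "run near_step NF t = run near_step NF t'" "run claw_step CF t = run claw_step CF t'"
    using 1 by (auto intro!: run_excise)
  moreover have "t \<noteq> Empty" using excise_size[OF 1(1)] by auto
  ultimately show ?case using 1(2) unfolding accepted_def by metis
qed (auto simp: accepted_def)

definition irreducible :: "arcs \<Rightarrow> bool" where
  "irreducible t \<longleftrightarrow> (\<nexists>p t'. excise p t t')"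

lemma irreducible_Arch:
  "irreducible (Arch a b) \<Longrightarrow> irreducible a \<and> irreducible b \<and> a \<noteq> arch1"
  unfolding irreducible_def using excise.intros by blast

text \<open>Without an excision no child is a single edge. Inductively \<open>arch1\<close> is the
  only such tree in state \<open>NM\<close>, so no child is in state \<open>NM\<close>, which leaves
  few shapes.\<close>

lemma irreducible_near:
  assumes "irreducible t"
  shows "(run near_step NF t = NF \<longrightarrow> t = Empty) \<and> (run near_step NF t = NM \<longrightarrow> t = arch1) \<and>
    (run near_step NF t = NE \<longrightarrow> (\<exists>d. t = Arch d Empty \<and> run near_step NF d = ND))"
  using assms
proof (induction t)
  case (Arch a b)
  then show ?case using irreducible_Arch[of a b] by auto
qed simp

lemma irreducible_claw:
  assumes "irreducible t"
  shows "(run claw_step CF t = CF \<longrightarrow> t = Empty) \<and> (run claw_step CF t = CM \<longrightarrow> t = arch1) \<and>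
    (run claw_step CF t = CR \<longrightarrow> t = Arch Empty arch1) \<and>
    (run claw_step CF t = CQ \<longrightarrow> (\<exists>d. t = Arch d Empty \<and> run claw_step CF d = CP))"
  using assms
proof (induction t)
  case (Arch a b)
  then show ?case using irreducible_Arch[of a b] by auto
qed simp

text \<open>An available excision preserves acceptance unless it leaves \<open>Empty\<close>, in
  which case \<open>t\<close> is a ring of size 2. In an irreducible tree each transition into an
  accepting state is impossible or exhibits a ring or a wrapped block.\<close>

lemma accepted_base_or_removal:
  assumes "accepted t"
  shows "t \<in> {Arch Empty arch1, Arch arch1 Empty, Arch Empty (Arch Empty arch1),
      Arch (Arch Empty arch1) Empty} \<or> (\<exists>i t'. removal i t t' \<and> accepted t')"
proof (cases "irreducible t")
  case False
  then obtain p t' where e: "excise p t t'" by (auto simp: irreducible_def)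
  have "run near_step NF t = run near_step NF t'" "run claw_step CF t = run claw_step CF t'"
    using e by (auto intro!: run_excise)
  then have "accepted t'" if "t' \<noteq> Empty"
    using assms that by (auto simp: accepted_def)
  moreover have "t = Arch arch1 Empty" if "t' = Empty"
    using e that by cases auto
  ultimately show ?thesis using e removal.intros(1) by blast
next
  case True
  have nonempty: "t \<noteq> Empty" using assms by (auto simp: accepted_def)
  then obtain a b where t: "t = Arch a b" by (cases t) auto
  have ir: "irreducible a" "irreducible b" "a \<noteq> arch1" using irreducible_Arch[of a b] True t by auto
  note N = irreducible_near[OF ir(1)] irreducible_near[OF ir(2)]
  note C = irreducible_claw[OF ir(1)] irreducible_claw[OF ir(2)]
  have ND: "accepted d" if "run near_step NF d = ND" for d
    using that by (auto simp: accepted_def)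
  have CP: "accepted d" if "run claw_step CF d = CP" for d
    using that by (auto simp: accepted_def)
  have rem: "\<exists>i. removal i (Arch d arch1) d" "\<exists>i. removal i (Arch (Arch d Empty) Empty) d"
    "\<exists>i. removal i (Arch Empty (Arch d Empty)) d" for d
    by (rule exI, rule removal.intros)+
  from assms consider "run near_step NF t = NF" | "run near_step NF t = ND" | "run claw_step CF t = CP"
    by (auto simp: accepted_def)
  then show ?thesis
  proof cases
    case 1
    with irreducible_near[OF True] nonempty show ?thesis by simp
  next
    case 2
    then consider "run near_step NF a = NM"
      | "run near_step NF a = NF" "run near_step NF b = NM"
      | "run near_step NF a = NF" "run near_step NF b = NE"
      | "run near_step NF a = ND" "run near_step NF b = NM"
      | "run near_step NF a = NE" "run near_step NF b = NF"
      unfolding t by auto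
    then show ?thesis
    proof cases
      case 1
      with N ir(3) show ?thesis by blast
    next
      case 2
      with N have "t = Arch Empty arch1" unfolding t by blast
      then show ?thesis by blast
    next
      case 3
      with N obtain d where "t = Arch Empty (Arch d Empty)" "run near_step NF d = ND"
        unfolding t by blast
      with ND rem show ?thesis by blast
    next
      case 4
      with N have "t = Arch a arch1" unfolding t by blast
      with ND[OF 4(1)] rem show ?thesis by blast
    next
      case 5
      with N obtain d where "t = Arch (Arch d Empty) Empty" "run near_step NF d = ND"
        unfolding t by blast
      with ND rem show ?thesis by blast
    qed
  next
    case 3
    then consider "run claw_step CF a = CM"
      | "run claw_step CF a = CF" "run claw_step CF b = CR"
      | "run claw_step CF a = CF" "run claw_step CF b = CQ"
      | "run claw_step CF a = CR" "run claw_step CF b = CF"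
      | "run claw_step CF a = CP" "run claw_step CF b = CM"
      | "run claw_step CF a = CQ" "run claw_step CF b = CF"
      unfolding t by auto
    then show ?thesis
    proof cases
      case 1
      with C ir(3) show ?thesis by blast
    next
      case 2
      with C have "t = Arch Empty (Arch Empty arch1)" unfolding t by blast
      then show ?thesis by blast
    next
      case 3
      with C obtain d where "t = Arch Empty (Arch d Empty)" "run claw_step CF d = CP"
        unfolding t by blast
      with CP rem show ?thesis by blast
    next
      case 4
      with C have "t = Arch (Arch Empty arch1) Empty" unfolding t by blast
      then show ?thesis by blast
    next
      case 5
      with C have "t = Arch a arch1" unfolding t by blast
      with CP[OF 5(1)] rem show ?thesis by blast
    next
      case 6
      with C obtain d where "t = Arch (Arch d Empty) Empty" "run claw_step CF d = CP"
        unfolding t by blast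
      with CP rem show ?thesis by blast
    qed
  qed
qed

lemma sets_lt_2: "{f j |j. j < (2::nat)} = {f 0, f 1}"
  by (auto simp: less_2_cases_iff)

lemma sets_lt_3: "{f j |j. j < (3::nat)} = {f 0, f 1, f 2}"
proof -
  have "j < 3 \<longleftrightarrow> j = 0 \<or> j = 1 \<or> j = 2" for j :: nat by auto
  then show ?thesis by auto
qed

lemma edges_rings:
  "edges 0 (Arch Empty arch1) = ring1 2"
  "edges 0 (Arch arch1 Empty) = ring2 2"
  "edges 0 (Arch Empty (Arch Empty arch1)) = ring1 3"
  "edges 0 (Arch (Arch Empty arch1) Empty) = ring2 3"
  unfolding ring1_def ring2_def sets_lt_2 sets_lt_3
  by (simp_all, simp_all add: eval_nat_numeral insert_commute)

text \<open>From left to right, acceptance survives the insertion of a block; from right to left, an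
  accepted tree is a small ring or has a block whose removal leaves an accepted tree.\<close>

lemma L_matching_iff:
  "L_matching k M \<longleftrightarrow> (\<exists>t. size t = k \<and> accepted t \<and> M = edges 0 t)"
proof
  assume "L_matching k M"
  then show "\<exists>t. size t = k \<and> accepted t \<and> M = edges 0 t"
  proof (induction rule: L_matching.induct)
    case (ring k M)
    let ?P = "\<lambda>t. size t = k \<and> accepted t \<and> M = edges 0 t"
    from ring have "?P (Arch Empty arch1) \<or> ?P (Arch arch1 Empty) \<or>
        ?P (Arch Empty (Arch Empty arch1)) \<or> ?P (Arch (Arch Empty arch1) Empty)"
      unfolding edges_rings by (auto simp: accepted_def)
    then show ?case by blast
  next
    case (step k N i)
    from step.hyps(2) obtain t where t: "size t = k" "N = edges 0 t"
      using matching_on_imp_edges[of 0 "2 * k" N] unfolding is_matching_iff by auto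
    obtain t' where r: "removal i t t'"
      using ex_removal[of i t] step.hyps t by auto
    from step.IH obtain u where u: "accepted u" "remove_block (2 * k) N i = edges 0 u" by blast
    with removal_edges[OF r] t have "edges 0 u = edges 0 t'" by simp
    then have "u = t'" by (rule edges_inj)
    with u r accepted_removal t show ?case by blast
  qed
next
  assume "\<exists>t. size t = k \<and> accepted t \<and> M = edges 0 t"
  then obtain t where "size t = k" "accepted t" "M = edges 0 t" by blast
  then show "L_matching k M"
  proof (induction k arbitrary: t M rule: less_induct)
    case (less k)
    from accepted_base_or_removal[OF less.prems(2)] show ?case
    proof
      assume "t \<in> {Arch Empty arch1, Arch arch1 Empty, Arch Empty (Arch Empty arch1),
        Arch (Arch Empty arch1) Empty}"
      moreover have "L_matching (size u) (edges 0 u)"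
        if "u = Arch Empty arch1 \<or> u = Arch arch1 Empty \<or> u = Arch Empty (Arch Empty arch1) \<or>
          u = Arch (Arch Empty arch1) Empty" for u
        using that by (elim disjE; simp only: edges_rings; intro L_matching.ring; simp add: eval_nat_numeral)
      ultimately have "L_matching (size t) (edges 0 t)" by simp
      then show ?thesis using less.prems by simp
    next
      assume "\<exists>i t'. removal i t t' \<and> accepted t'"
      then obtain i t' where r: "removal i t t'" "accepted t'" by blast
      note sz = removal_size[OF r(1)]
      \<comment> \<open>No tree with at most one arc is accepted, which gives the bound
        \<open>k \<ge> 4\<close> required by the rule \<open>step\<close>.\<close>
      have "size t' \<noteq> 0" "size t' \<noteq> 1" using r(2)
        by (auto simp: accepted_def size_arcs_1)
      then have "k \<ge> 4" using sz less.prems(1) by linarith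
      moreover have "is_matching (2 * k) M"
        using matching_on_edges[of 0 t] less.prems by (simp add: is_matching_iff)
      moreover have "L_matching (k - 2) (edges 0 t')"
        using less.IH[of "k - 2" t'] sz less.prems(1) r(2) by simp
      moreover have "i < 2 * k" "block_at (2 * k) i \<subseteq> M" "remove_block (2 * k) M i = edges 0 t'"
        using removal_edges[OF r(1)] sz less.prems by auto
      ultimately show ?thesis by (metis L_matching.step)
    qed
  qed
qed

section \<open>Fuss--Catalan numbers\<close>

text \<open>For \<open>m > 0\<close> this is \<open>r / (4 m + r) * binom (4 m + r) m\<close>, the Fuss--Catalan (Raney) number.\<close>

definition fuss :: "nat \<Rightarrow> nat \<Rightarrow> real" where
  "fuss r m = (if m = 0 then 1 else real r / real m * real ((4 * m + r - 1) choose (m - 1)))"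

lemma fuss_0_right [simp]: "fuss r 0 = 1"
  by (simp add: fuss_def)

lemma fuss_0_left: "m > 0 \<Longrightarrow> fuss 0 m = 0"
  by (simp add: fuss_def)

text \<open>The coefficient form of \<open>F^(r+1) = F^r + z^2 F^(r+4)\<close>; it follows from
  Pascal's rule and absorption.\<close>

lemma fuss_Suc: "fuss (Suc r) (Suc m) = fuss r (Suc m) + fuss (r + 4) m"
proof (cases m)
  case 0
  then show ?thesis by (simp add: fuss_def)
next
  case (Suc j)
  \<comment> \<open>The common upper index of both binomials on the right; the left one has
    \<open>Suc N\<close>.\<close>
  define N where "N = 4 * j + r + 7"
  have 1: "real (Suc j) * real (Suc N choose Suc j) = real (Suc N) * real (N choose j)"
    using Suc_times_binomial_eq[of N j] by (metis mult.commute of_nat_mult)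
  have 2: "real (Suc N choose Suc j) = real (N choose j) + real (N choose Suc j)"
    by simp
  have 3: "fuss (Suc r) (Suc m) = real (Suc r) / real (j + 2) * real (Suc N choose Suc j)"
    by (simp add: fuss_def Suc N_def add_ac)
  have 4: "fuss r (Suc m) = real r / real (j + 2) * real (N choose Suc j)"
    by (simp add: fuss_def Suc N_def add_ac)
  have 5: "fuss (r + 4) m = real (r + 4) / real (Suc j) * real (N choose j)"
    by (simp add: fuss_def Suc N_def add_ac)
  define x y J where "x = real (N choose j)" and "y = real (N choose Suc j)" and "J = real j"
  have J: "J \<ge> 0" by (simp add: J_def)
  have a: "(J + 1) * (x + y) = (4 * J + r + 8) * x"
    using 1 2 by (simp add: x_def y_def J_def N_def algebra_simps)
  have "(real r + 1) / (J + 2) * (x + y) = real r / (J + 2) * y + (real r + 4) / (J + 1) * x"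
  proof -
    have "(real r + 1) * (x + y) * (J + 1) = real r * y * (J + 1) + (real r + 4) * x * (J + 2)"
      using a by algebra
    then show ?thesis using J by (simp add: divide_simps)
  qed
  then show ?thesis unfolding 3 4 5 2 by (simp add: x_def y_def J_def add_ac)
qed

text \<open>The recurrence lowers \<open>r\<close>, or lowers \<open>m\<close> while raising
  \<open>r\<close> by 4; hence an outer induction on \<open>m\<close> for all \<open>r\<close> and
  an inner one on \<open>r\<close>.\<close>

lemma fps_power_fuss:
  fixes F :: "real fps"
  assumes F: "F = 1 + fps_X ^ 2 * F ^ 4"
  shows "fps_nth (F ^ r) (2 * m) = fuss r m"
proof (induction m arbitrary: r)
  case 0
  have "fps_nth F 0 = 1" by (subst F) (simp add: power2_eq_square mult.assoc)
  then show ?case by (simp add: fps_nth_power_0)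
next
  case (Suc m)
  note outer = Suc.IH
  show ?case
  proof (induction r)
    case 0
    then show ?case by (simp add: fuss_0_left)
  next
    case (Suc r)
    have "F ^ Suc r = F ^ r * F" by simp
    also have "\<dots> = F ^ r + fps_X ^ 2 * F ^ (r + 4)"
      by (subst (2) F) (simp add: algebra_simps power_add)
    finally show ?case using Suc outer[of "r + 4"] by (simp add: fps_X_power_mult_nth fuss_Suc)
  qed
qed

section \<open>Counting\<close>

definition arcs_of_size :: "nat \<Rightarrow> arcs set" where
  "arcs_of_size n = {t. size t = n}"

lemma arcs_of_size_0: "arcs_of_size 0 = {Empty}"
  by (auto simp: arcs_of_size_def)

lemma arcs_of_size_Suc:
  "arcs_of_size (Suc n) = (\<Union>i\<le>n. case_prod Arch ` (arcs_of_size i \<times> arcs_of_size (n - i)))"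
proof (intro set_eqI iffI)
  fix t assume "t \<in> arcs_of_size (Suc n)"
  then obtain a b where "t = Arch a b" "size a + size b = n"
    by (cases t) (auto simp: arcs_of_size_def)
  then show "t \<in> (\<Union>i\<le>n. case_prod Arch ` (arcs_of_size i \<times> arcs_of_size (n - i)))"
    by (auto simp: arcs_of_size_def intro!: bexI[of _ "size a"])
qed (auto simp: arcs_of_size_def)

lemma finite_arcs_of_size: "finite (arcs_of_size n)"
  by (induction n rule: less_induct) (case_tac x; simp add: arcs_of_size_0 arcs_of_size_Suc)

section \<open>Generating functions of automaton runs\<close>

definition run_gf :: "('s \<Rightarrow> 's \<Rightarrow> 's) \<Rightarrow> 's \<Rightarrow> 's \<Rightarrow> real fps" where
  "run_gf f q s = Abs_fps (\<lambda>n. \<Sum>t\<in>arcs_of_size n. of_bool (run f q t = s))"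

lemma run_gf_nth: "fps_nth (run_gf f q s) n = real (card {t. size t = n \<and> run f q t = s})"
proof -
  have "{t. size t = n \<and> run f q t = s} = arcs_of_size n \<inter> {t. run f q t = s}"
    by (auto simp: arcs_of_size_def)
  then show ?thesis by (simp add: run_gf_def finite_arcs_of_size)
qed

lemma sum_arcs_of_size_Suc:
  fixes g :: "arcs \<Rightarrow> real"
  shows "(\<Sum>t\<in>arcs_of_size (Suc n). g t) =
    (\<Sum>i\<le>n. \<Sum>a\<in>arcs_of_size i. \<Sum>b\<in>arcs_of_size (n - i). g (Arch a b))"
proof -
  have "(\<Sum>t\<in>arcs_of_size (Suc n). g t) =
      (\<Sum>i\<le>n. \<Sum>t\<in>case_prod Arch ` (arcs_of_size i \<times> arcs_of_size (n - i)). g t)"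
    unfolding arcs_of_size_Suc
    by (rule sum.UNION_disjoint) (auto simp: finite_arcs_of_size, auto simp: arcs_of_size_def)
  also have "\<dots> = (\<Sum>i\<le>n. \<Sum>(a, b)\<in>arcs_of_size i \<times> arcs_of_size (n - i). g (Arch a b))"
    by (intro sum.cong refl, subst sum.reindex)
      (auto simp: inj_on_def case_prod_beta intro!: sum.cong)
  finally show ?thesis by (simp add: sum.cartesian_product)
qed

text \<open>A nonempty tree is a pair of subtrees plus one arc, which contributes
  \<open>fps_X\<close>, and its state depends only on the states of the pair.\<close>

lemma run_gf_eq:
  fixes f :: "'s::finite \<Rightarrow> 's \<Rightarrow> 's"
  shows "run_gf f q s = of_bool (q = s) +
    fps_X * (\<Sum>x\<in>UNIV. \<Sum>y\<in>UNIV. of_bool (f x y = s) * (run_gf f q x * run_gf f q y))"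
proof (rule fps_ext)
  fix n
  show "fps_nth (run_gf f q s) n = fps_nth (of_bool (q = s) +
    fps_X * (\<Sum>x\<in>UNIV. \<Sum>y\<in>UNIV. of_bool (f x y = s) * (run_gf f q x * run_gf f q y))) n"
  proof (cases n)
    case 0
    then show ?thesis by (simp add: run_gf_def arcs_of_size_0)
  next
    case (Suc m)
    \<comment> \<open>Splitting the indicator by the pair of states makes the sum over pairs of
      subtrees factor.\<close>
    have *: "of_bool (f u v = s) = (\<Sum>z\<in>UNIV. of_bool (f (fst z) (snd z) = s) *
        (of_bool (u = fst z) * of_bool (v = snd z)) :: real)" for u v
    proof -
      have "(\<Sum>z\<in>UNIV. of_bool (f (fst z) (snd z) = s) *
          (of_bool (u = fst z) * of_bool (v = snd z)) :: real)
        = (\<Sum>z\<in>UNIV. if z = (u, v) then of_bool (f (fst z) (snd z) = s) else 0)"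
        by (intro sum.cong refl) auto
      then show ?thesis by simp
    qed
    have "fps_nth (run_gf f q s) n =
      (\<Sum>i\<le>m. \<Sum>a\<in>arcs_of_size i. \<Sum>b\<in>arcs_of_size (m - i). \<Sum>z\<in>UNIV.
        of_bool (f (fst z) (snd z) = s) *
        (of_bool (run f q a = fst z) * of_bool (run f q b = snd z)))"
      unfolding Suc run_gf_def fps_nth_Abs_fps sum_arcs_of_size_Suc run.simps by (subst *) (rule refl)
    also have "\<dots> = (\<Sum>z\<in>UNIV. \<Sum>i\<le>m. \<Sum>a\<in>arcs_of_size i. \<Sum>b\<in>arcs_of_size (m - i).
        of_bool (f (fst z) (snd z) = s) *
        (of_bool (run f q a = fst z) * of_bool (run f q b = snd z)))"
      by (simp only: sum.swap[where B = "UNIV :: ('s \<times> 's) set"])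
    also have "\<dots> = (\<Sum>z\<in>UNIV. of_bool (f (fst z) (snd z) = s) *
        (\<Sum>i=0..m. fps_nth (run_gf f q (fst z)) i * fps_nth (run_gf f q (snd z)) (m - i)))"
      by (intro sum.cong refl)
        (simp only: run_gf_def fps_nth_Abs_fps sum_product atLeast0AtMost, simp only: sum_distrib_left)
    also have "\<dots> = (\<Sum>x\<in>UNIV. \<Sum>y\<in>UNIV. of_bool (f x y = s) *
        (\<Sum>i=0..m. fps_nth (run_gf f q x) i * fps_nth (run_gf f q y) (m - i)))"
      by (simp only: sum.cartesian_product UNIV_Times_UNIV case_prod_unfold)
    also have "\<dots> = fps_nth (of_bool (q = s) +
      fps_X * (\<Sum>x\<in>UNIV. \<Sum>y\<in>UNIV. of_bool (f x y = s) * (run_gf f q x * run_gf f q y))) n"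
    proof -
      have "fps_nth (of_bool P * G) k = of_bool P * fps_nth G k" for P k and G :: "real fps"
        by (cases P) auto
      moreover have "fps_nth (of_bool P :: real fps) (Suc m) = 0" for P
        by (cases P) auto
      ultimately show ?thesis by (simp add: Suc fps_sum_nth fps_mult_nth[of "run_gf f q _"])
    qed
    finally show ?thesis .
  qed
qed

lemma UNIV_near: "UNIV = {NF, NM, ND, NE, NB}"
  using near.exhaust by blast

lemma UNIV_claw: "UNIV = {CF, CM, CR, CP, CQ, CB}"
  using claw.exhaust by blast

instance near :: finite
  by standard (simp add: UNIV_near)

instance claw :: finite
  by standard (simp add: UNIV_claw)

abbreviation near_gf :: "near \<Rightarrow> real fps" where
  "near_gf \<equiv> run_gf near_step NF"

abbreviation claw_gf :: "claw \<Rightarrow> real fps" where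
  "claw_gf \<equiv> run_gf claw_step CF"

text \<open>\<open>NB\<close> is absorbing, so the other four series form a closed system; likewise
  for \<open>CB\<close> below.\<close>

lemma near_gf_eqs:
  "near_gf NF = 1 + fps_X * (near_gf NM * near_gf NF)"
  "near_gf NM = fps_X * (near_gf NF * near_gf NF + near_gf NM * near_gf NM)"
  "near_gf ND = fps_X * (near_gf NF * near_gf NM + near_gf NF * near_gf NE +
     near_gf NM * near_gf ND + near_gf ND * near_gf NM + near_gf NE * near_gf NF)"
  "near_gf NE = fps_X * (near_gf NM * near_gf NE + near_gf ND * near_gf NF)"
  by (subst run_gf_eq, simp add: UNIV_near algebra_simps)+

lemma claw_gf_eqs:
  "claw_gf CF = 1 + fps_X * (claw_gf CM * claw_gf CF)"
  "claw_gf CM = fps_X * (claw_gf CF * claw_gf CF + claw_gf CM * claw_gf CM)"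
  "claw_gf CR = fps_X * (claw_gf CF * claw_gf CM + claw_gf CM * claw_gf CR)"
  "claw_gf CP = fps_X * (claw_gf CM * claw_gf CP + claw_gf CF * claw_gf CR + claw_gf CF * claw_gf CQ +
     claw_gf CP * claw_gf CM + claw_gf CR * claw_gf CF + claw_gf CQ * claw_gf CF)"
  "claw_gf CQ = fps_X * (claw_gf CM * claw_gf CQ + claw_gf CP * claw_gf CF)"
  by (subst run_gf_eq, simp add: UNIV_claw algebra_simps)+


section \<open>Numbers of L-matchings as coefficients\<close>

lemma L_matching_card:
  "card {M. L_matching k M} = card {t. size t = k \<and> accepted t}"
proof -
  have "{M. L_matching k M} = edges 0 ` {t. size t = k \<and> accepted t}"
    by (auto simp: L_matching_iff)
  moreover have "inj_on (edges 0) A" for A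
    by (rule inj_onI) (rule edges_inj)
  ultimately show ?thesis by (simp add: card_image)
qed

lemma L_matching_card_odd:
  assumes "odd k"
  shows "real (card {M. L_matching k M}) = fps_nth (claw_gf CP) k"
proof -
  have "{t. size t = k \<and> accepted t} = {t. size t = k \<and> run claw_step CF t = CP}"
    using near_parity assms unfolding accepted_def by blast
  then show ?thesis by (simp add: L_matching_card run_gf_nth)
qed

lemma L_matching_card_even:
  assumes "even k" "k \<ge> 1"
  shows "real (card {M. L_matching k M}) = fps_nth (near_gf NF) k + fps_nth (near_gf ND) k"
proof -
  have fin: "finite {t :: arcs. size t = k \<and> P t}" for P
    using finite_arcs_of_size[of k] by (rule rev_finite_subset) (auto simp: arcs_of_size_def)
  have "{t. size t = k \<and> accepted t} =
      {t. size t = k \<and> run near_step NF t = NF} \<union> {t. size t = k \<and> run near_step NF t = ND}"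
    using claw_parity assms by (auto simp: accepted_def)
  moreover have "{t. size t = k \<and> run near_step NF t = NF} \<inter> {t. size t = k \<and> run near_step NF t = ND} = {}"
    by auto
  ultimately show ?thesis
    by (simp add: L_matching_card run_gf_nth card_Un_disjoint fin)
qed

section \<open>Solving the functional equations\<close>

lemma eq_mult_of_inverse:
  fixes a b f u :: "'a::comm_ring_1"
  assumes "f * u = 1" and "a * u = b"
  shows "a = f * b"
proof -
  have "f * (a * u) = a * (f * u)" by (simp add: mult_ac)
  with assms show ?thesis by simp
qed

text \<open>The equation for \<open>F\<close> makes it the inverse of \<open>1 - fps_X * M\<close>,
  the factor that also arises in the equation for \<open>M\<close>.\<close>

lemma fps_matched_eq:
  fixes F M :: "real fps"
  assumes F: "F = 1 + fps_X * (M * F)" and M: "M = fps_X * (F * F + M * M)"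
  shows "M = fps_X * F ^ 3" and "F = 1 + fps_X ^ 2 * F ^ 4"
proof -
  have *: "F * (1 - fps_X * M) = 1" using F by (simp add: algebra_simps)
  have "M * (1 - fps_X * M) = fps_X * F ^ 2" using M by (simp add: algebra_simps power2_eq_square)
  from eq_mult_of_inverse[OF * this] show 1: "M = fps_X * F ^ 3"
    by (simp add: power2_eq_square power3_eq_cube mult_ac)
  show "F = 1 + fps_X ^ 2 * F ^ 4"
    using F unfolding 1 by (simp add: power2_eq_square eval_nat_numeral mult_ac)
qed

lemma fps_one_minus_X_neq_0: "1 - fps_X * G \<noteq> (0 :: real fps)"
proof
  assume "1 - fps_X * G = 0"
  then have "fps_nth (1 - fps_X * G) 0 = 0" by simp
  then show False by simp
qed

text \<open>Implicit differentiation. The factor beside the derivative recurs in the linear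
  equations for \<open>ND\<close> and \<open>CP\<close>, so these series become expressions in the
  derivative of \<open>F\<close>.\<close>

lemma fps_deriv_quartic:
  fixes F :: "real fps"
  assumes F: "F = 1 + fps_X ^ 2 * F ^ 4"
  shows "fps_deriv F * (1 - 4 * fps_X ^ 2 * F ^ 3) = 2 * fps_X * F ^ 4"
proof -
  have "fps_deriv F = fps_deriv (1 + fps_X ^ 2 * F ^ 4)" using F by simp
  also have "\<dots> = 2 * fps_X * F ^ 4 + fps_X ^ 2 * (4 * F ^ 3 * fps_deriv F)"
    by (simp add: fps_deriv_power power2_eq_square eval_nat_numeral fps_of_nat[symmetric] algebra_simps)
  finally show ?thesis by (simp add: algebra_simps)
qed

text \<open>Eliminating \<open>E\<close> and \<open>M\<close> leaves a linear equation for
  \<open>D\<close>, proportional to the differentiated quartic. The common factor has constant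
  coefficient 1 and cancels.\<close>

lemma near_fps:
  fixes F M D E :: "real fps"
  assumes F: "F = 1 + fps_X * (M * F)" and M: "M = fps_X * (F * F + M * M)"
    and D: "D = fps_X * (F * M + F * E + M * D + D * M + E * F)"
    and E: "E = fps_X * (M * E + D * F)"
  shows "2 * D = fps_X * fps_deriv F"
proof -
  note MF = fps_matched_eq[OF F M]
  let ?X = "fps_X :: real fps"
  have *: "F * (1 - ?X * M) = 1" using F by (simp add: algebra_simps)
  have "E * (1 - ?X * M) = ?X * D * F" using E by (simp add: algebra_simps)
  from eq_mult_of_inverse[OF * this] have E': "E = ?X * D * F ^ 2"
    by (simp add: power2_eq_square mult_ac)
  have D1: "D * (1 - 4 * ?X ^ 2 * F ^ 3) = ?X ^ 2 * F ^ 4"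
    using D unfolding E' MF(1) by (simp add: algebra_simps eval_nat_numeral)
  have "2 * D * (1 - 4 * ?X ^ 2 * F ^ 3) = ?X * fps_deriv F * (1 - 4 * ?X ^ 2 * F ^ 3)"
    using fps_deriv_quartic[OF MF(2)] D1 by (simp add: mult.assoc power2_eq_square)
  moreover have "1 - 4 * ?X ^ 2 * F ^ 3 \<noteq> 0"
    using fps_one_minus_X_neq_0[of "4 * ?X * F ^ 3"] by (simp add: power2_eq_square mult_ac)
  ultimately show ?thesis by simp
qed

text \<open>Eliminating \<open>Q\<close>, \<open>R\<close> and \<open>M\<close> gives a linear
  equation for \<open>P\<close> with the same factor; hence \<open>P\<close> is
  \<open>fps_X ^ 2 * F ^ 2\<close> times the derivative of \<open>F\<close>.\<close>

lemma claw_fps: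
  fixes F M R P Q :: "real fps"
  assumes F: "F = 1 + fps_X * (M * F)" and M: "M = fps_X * (F * F + M * M)"
    and R: "R = fps_X * (F * M + M * R)"
    and P: "P = fps_X * (M * P + F * R + F * Q + P * M + R * F + Q * F)"
    and Q: "Q = fps_X * (M * Q + P * F)"
  shows "3 * P = fps_X ^ 2 * fps_deriv (F ^ 3)"
proof -
  note MF = fps_matched_eq[OF F M]
  let ?X = "fps_X :: real fps"
  have *: "F * (1 - ?X * M) = 1" using F by (simp add: algebra_simps)
  have "Q * (1 - ?X * M) = ?X * P * F" using Q by (simp add: algebra_simps)
  from eq_mult_of_inverse[OF * this] have Q': "Q = ?X * P * F ^ 2"
    by (simp add: power2_eq_square mult_ac)
  have "R * (1 - ?X * M) = ?X * F * M" using R by (simp add: algebra_simps)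
  from eq_mult_of_inverse[OF * this] have R': "R = ?X ^ 2 * F ^ 5"
    unfolding MF(1) by (simp add: eval_nat_numeral mult_ac)
  have P1: "P * (1 - 4 * ?X ^ 2 * F ^ 3) = 2 * ?X ^ 3 * F ^ 6"
    using P unfolding Q' R' MF(1) by (simp add: algebra_simps eval_nat_numeral)
  have "?X ^ 2 * F ^ 2 * fps_deriv F * (1 - 4 * ?X ^ 2 * F ^ 3) = ?X ^ 2 * F ^ 2 * (2 * ?X * F ^ 4)"
    using fps_deriv_quartic[OF MF(2)] by (simp add: mult.assoc)
  also have "\<dots> = 2 * ?X ^ 3 * F ^ 6" by (simp add: algebra_simps eval_nat_numeral)
  finally have "P * (1 - 4 * ?X ^ 2 * F ^ 3) = ?X ^ 2 * F ^ 2 * fps_deriv F * (1 - 4 * ?X ^ 2 * F ^ 3)"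
    using P1 by simp
  moreover have "1 - 4 * ?X ^ 2 * F ^ 3 \<noteq> 0"
    using fps_one_minus_X_neq_0[of "4 * ?X * F ^ 3"] by (simp add: power2_eq_square mult_ac)
  ultimately have "P = ?X ^ 2 * F ^ 2 * fps_deriv F" by simp
  then show ?thesis
    by (simp add: fps_deriv_power numeral_fps_const algebra_simps)
qed

lemma L_matching_card_even_eq:
  assumes "m \<ge> 1"
  shows "real (card {M. L_matching (2 * m) M}) = (real m + 1) * fuss 1 m"
proof -
  let ?F = "near_gf NF" and ?D = "near_gf ND"
  have "2 * fps_nth ?D (2 * m) = fps_nth (fps_X * fps_deriv ?F) (2 * m)"
    by (simp flip: near_fps[OF near_gf_eqs] add: numeral_fps_const)
  moreover have "fps_nth ?F (2 * m) = fuss 1 m"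
    using fps_power_fuss[OF fps_matched_eq(2)[OF near_gf_eqs(1,2)], of 1 m] by simp
  ultimately have "fps_nth ?D (2 * m) = real m * fuss 1 m"
    using assms by (simp add: of_nat_diff)
  with \<open>fps_nth ?F (2 * m) = fuss 1 m\<close> show ?thesis
    using L_matching_card_even[of "2 * m"] assms by (simp add: algebra_simps)
qed

lemma L_matching_card_odd_eq:
  "real (card {M. L_matching (2 * m + 1) M}) = 2 / 3 * real m * fuss 3 m"
proof -
  let ?F = "claw_gf CF" and ?P = "claw_gf CP"
  have "3 * fps_nth ?P (2 * m + 1) = fps_nth (fps_X ^ 2 * fps_deriv (?F ^ 3)) (2 * m + 1)"
    by (simp flip: claw_fps[OF claw_gf_eqs] add: numeral_fps_const)
  also have "\<dots> = 2 * real m * fps_nth (?F ^ 3) (2 * m)"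
    \<comment> \<open>For \<open>m = 0\<close> the index 1 lies below the shift by 2, and both sides
      vanish.\<close>
    by (cases m) (simp_all add: fps_X_power_mult_nth)
  also have "fps_nth (?F ^ 3) (2 * m) = fuss 3 m"
    by (rule fps_power_fuss[OF fps_matched_eq(2)[OF claw_gf_eqs(1,2)]])
  finally show ?thesis using L_matching_card_odd[of "2 * m + 1"] by simp
qed

section \<open>Binomial closed forms\<close>

lemma choose_Suc_mult: "(real n - real k) * real (n choose k) = real (Suc k) * real (n choose Suc k)"
proof (cases "k \<le> n")
  case True
  have "(n - k) * (n choose k) = Suc k * (n choose Suc k)"
    by (simp only: binomial_absorb_comp binomial_absorption)
  then have "real ((n - k) * (n choose k)) = real (Suc k * (n choose Suc k))"
    by (rule arg_cong)
  with True show ?thesis by (simp only: of_nat_mult of_nat_diff)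
qed (simp add: binomial_eq_0)

text \<open>The definition of \<open>fuss\<close> has lower index \<open>m - 1\<close>;
  \<open>choose_Suc_mult\<close> raises it to \<open>m\<close>.\<close>

lemma fuss_1: "fuss 1 m = real ((4 * m) choose m) / (3 * real m + 1)"
proof (cases m)
  case (Suc j)
  have "(real (4 * m) - real j) * real ((4 * m) choose j) = real m * real ((4 * m) choose m)"
    using choose_Suc_mult[of "4 * m" j] Suc by simp
  moreover have "real (4 * m) - real j = 3 * real m + 1" using Suc by simp
  ultimately have "(3 * real m + 1) * real ((4 * m) choose j) = real m * real ((4 * m) choose m)"
    by (simp only:)
  moreover have "real ((4 * m) choose j) = real m * fuss 1 m" using Suc by (simp add: fuss_def)
  ultimately have "real m * ((3 * real m + 1) * fuss 1 m) = real m * real ((4 * m) choose m)"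
    by (simp only: mult.left_commute)
  then have "(3 * real m + 1) * fuss 1 m = real ((4 * m) choose m)" using Suc by simp
  moreover have "3 * real m + 1 > 0" by simp
  ultimately show ?thesis by (simp add: divide_simps mult.commute)
qed simp

lemma fuss_3: "real m * fuss 3 m = real m / (real m + 1) * real ((4 * m + 2) choose m)"
proof (cases m)
  case (Suc j)
  have "(real (4 * m + 2) - real j) * real ((4 * m + 2) choose j) = real m * real ((4 * m + 2) choose m)"
    using choose_Suc_mult[of "4 * m + 2" j] Suc by simp
  moreover have "real (4 * m + 2) - real j = 3 * (real m + 1)" using Suc by simp
  ultimately have "3 * (real m + 1) * real ((4 * m + 2) choose j) = real m * real ((4 * m + 2) choose m)"
    by (simp only:)
  moreover have "real m * fuss 3 m = 3 * real ((4 * m + 2) choose j)"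
    using Suc by (simp add: fuss_def)
  moreover have "real m + 1 > 0" by simp
  ultimately show ?thesis by (simp add: field_simps)
qed simp

theorem mainTheorem14:
  fixes k :: nat
  assumes "k \<ge> 1"
  defines "l \<equiv> (k + 1) div 2"
  shows "(odd k \<longrightarrow> real (card {M. L_matching k M})
            = 2 / 3 * ((real l - 1) / real l) * real ((4*l - 2) choose (l - 1))) \<and>
         (even k \<longrightarrow> real (card {M. L_matching k M})
            = (real l + 1) / (3 * real l + 1) * real ((4*l) choose l))"
proof (intro conjI impI)
  assume "odd k"
  then obtain m where k: "k = 2 * m + 1" by (auto elim: oddE)
  then have l: "l = m + 1" by (simp add: l_def)
  then have l': "4 * l - 2 = 4 * m + 2" "l - 1 = m" "real l - 1 = real m" "real l = real m + 1"
    by simp_all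
  show "real (card {M. L_matching k M})
      = 2 / 3 * ((real l - 1) / real l) * real ((4*l - 2) choose (l - 1))"
    \<comment> \<open>\<open>real l - 1\<close> is rewritten before \<open>real l\<close>, which
      would otherwise destroy that pattern.\<close>
    unfolding l'(1-3) unfolding l'(4) k L_matching_card_odd_eq by (simp only: mult.assoc fuss_3)
next
  assume "even k"
  then obtain m where k: "k = 2 * m" by (auto elim: evenE)
  then have "l = m" "m \<ge> 1" using assms(1) by (simp_all add: l_def)
  then show "real (card {M. L_matching k M})
      = (real l + 1) / (3 * real l + 1) * real ((4*l) choose l)"
    using L_matching_card_even_eq[of m] fuss_1[of m] by (simp add: k)
qed

end
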